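(* Let $q\in\mathbb{C}$ with $0<|q|<1$. (1) If $w\in\mathbb{C}$ satisfies $|w|>|q|$ and $w\neq q^{2\ell+1}$ for all $\ell\in\mathbb{Z}$, then $$\kappa(w;q)=K_1(w;q).$$ (2) If $w\in\mathbb{C}\setminus\{0\}$ satisfies $w\neq q^{\ell}$ for all $\ell\in\mathbb{Z}$, then $$K_1(w;q)=-\frac{w}{(1-w)^2}\left(K(w;q)-\frac{(q;q^2)_\infty^3\,(q^2;q^2)_\infty}{(wq,w^{-1}q;q)_\infty}\right).$$
   Context: Notation: for a base $p$, $(a;p)_n:=\prod_{j=0}^{n-1}(1-ap^j)$ for $n\in\mathbb{N}_0$, $(a;p)_\infty:=\prod_{j\ge0}(1-ap^j)$ for $|p|<1$, and $(a_1,\dots,a_r;p)_n:=(a_1;p)_n\cdots(a_r;p)_n$ (also for $n=\infty$). Definitions: $$K(w;q):=\sum_{n\ge0}\frac{(-1)^nq^{n^2}(q;q^2)_n}{(wq^2,w^{-1}q^2;q^2)_n}\qquad(w\neq0,\ w\neq q^{2\ell}\text{ for }\ell\in\mathbb{Z}\setminus\{0\}),$$ $$K_1(w;q):=\sum_{n\ge1}\frac{(-1)^{n-1}q^{n^2}(q;q^2)_{n-1}}{(wq,w^{-1}q;q^2)_n}\qquad(w\neq0,\ w\neq q^{2\ell+1}\text{ for }\ell\in\mathbb{Z}),$$ $$\kappa(w;q):=\sum_{n\ge0}\frac{q^{n+1}w^{-n}(wq^2;q^2)_n}{(wq;q^2)_{n+1}}\qquad(|w|>|q|,\ w\neq q^{-2\ell+1}\text{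 for }\ell\in\mathbb{N}=\{1,2,\dots\}).$$ *)

theory Defs
  imports "HOL-Analysis.Analysis"
begin

definition qpoch :: "complex \<Rightarrow> complex \<Rightarrow> nat \<Rightarrow> complex" where
  "qpoch a p n = (\<Prod>j<n. 1 - a * p ^ j)"

text \<open>For \<open>norm p < 1\<close> the product converges in the sense of \<open>convergent_prod\<close>, vanishing
  factors included, so \<open>prodinf\<close> is its genuine value.\<close>

definition qpoch_inf :: "complex \<Rightarrow> complex \<Rightarrow> complex" where
  "qpoch_inf a p = (\<Prod>j. 1 - a * p ^ j)"

text \<open>The symbols with several parameters are products of those with one parameter:
  \<open>(a, b; p)\<^sub>n = (a; p)\<^sub>n (b; p)\<^sub>n\<close>. The three series below are meaningful only where no
  denominator vanishes and, for \<open>kappa\<close>, where \<open>norm w > norm q\<close>; these conditions on \<open>w\<close>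
  are left to the places where the functions are used.\<close>

definition K :: "complex \<Rightarrow> complex \<Rightarrow> complex" where
  "K w q = (\<Sum>n. (-1) ^ n * q ^ (n\<^sup>2) * qpoch q (q\<^sup>2) n /
                  (qpoch (w * q\<^sup>2) (q\<^sup>2) n * qpoch (inverse w * q\<^sup>2) (q\<^sup>2) n))"

text \<open>The series for \<open>K1\<close> starts at \<open>n = 1\<close>; here \<open>n = m + 1\<close>.\<close>

definition K1 :: "complex \<Rightarrow> complex \<Rightarrow> complex" where
  "K1 w q = (\<Sum>m. (-1) ^ m * q ^ ((m + 1)\<^sup>2) * qpoch q (q\<^sup>2) m /
                   (qpoch (w * q) (q\<^sup>2) (m + 1) * qpoch (inverse w * q) (q\<^sup>2) (m + 1)))"

definition kappa :: "complex \<Rightarrow> complex \<Rightarrow> complex" where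
  "kappa w q = (\<Sum>n. q ^ (n + 1) * inverse w ^ n * qpoch (w * q\<^sup>2) (q\<^sup>2) n /
                      qpoch (w * q) (q\<^sup>2) (n + 1))"

end

theory Submission
  imports Defs "HOL-Complex_Analysis.Conformal_Mappings"
begin

text \<open>
  Part (1) is a case of Jackson's transformation, obtained by iterating a first-order functional
  equation of Fine's function \<open>\<Sum>n. (b;p)\<^sub>n / (c;p)\<^sub>n z\<^sup>n\<close> with \<open>p = q\<^sup>2\<close>.

  For part (2), multiplying \<open>K\<close> and \<open>K1\<close> by the infinite products in their denominators gives
  functions \<open>k\<close> and \<open>k1\<close> holomorphic in \<open>w \<noteq> 0\<close> and invariant under \<open>w \<mapsto> 1/w\<close>. A telescoping
  sum expresses \<open>k1(qw)\<close> through \<open>k(w)\<close>, and by the symmetry also \<open>k(qw)\<close> through \<open>k1(w)\<close>. It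
  follows that \<open>(wq, q/w; p)\<^sub>\<infinity> k(w) - (w, 1/w; p)\<^sub>\<infinity> k1(w)\<close> is invariant under \<open>w \<mapsto> qw\<close>, hence
  constant. At \<open>w = 1\<close> the second product vanishes and \<open>k(1)\<close> is summed by the same
  transformation of Fine's function.
\<close>

section \<open>The $q$-Pochhammer symbol\<close>

lemma qpoch_0 [simp]: "qpoch a p 0 = 1"
  by (simp add: qpoch_def)

lemma qpoch_Suc: "qpoch a p (Suc n) = qpoch a p n * (1 - a * p ^ n)"
  by (simp add: qpoch_def)

lemma qpoch_add: "qpoch a p (n + m) = qpoch a p n * qpoch (a * p ^ n) p m"
  by (induction m) (simp_all add: qpoch_Suc power_add mult.assoc)

lemma qpoch_Suc_shift: "qpoch a p (Suc n) = (1 - a) * qpoch (a * p) p n"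
  using qpoch_add[of a p 1 n] by (simp add: qpoch_Suc)

lemma qpoch_nonzero: "(\<And>j. a * p ^ j \<noteq> 1) \<Longrightarrow> qpoch a p n \<noteq> 0"
  by (auto simp: qpoch_def)

text \<open>Each factor is at most \<open>exp (R * norm p ^ j)\<close>, and the exponents form a
  geometric series. The bound depends on neither \<open>n\<close> nor the position of
  \<open>a\<close> in the disc, as the later majorants require.\<close>

lemma norm_qpoch_le:
  assumes "norm p < 1" "norm a \<le> R"
  shows "norm (qpoch a p n) \<le> exp (R / (1 - norm p))"
proof -
  have R: "R \<ge> 0" using assms(2) norm_ge_zero order_trans by blast
  have "norm (qpoch a p n) = (\<Prod>j<n. norm (1 - a * p ^ j))"
    by (simp add: qpoch_def prod_norm)
  also have "\<dots> \<le> (\<Prod>j<n. exp (R * norm p ^ j))"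
  proof (intro prod_mono conjI)
    fix j
    have "norm (1 - a * p ^ j) \<le> 1 + norm a * norm p ^ j"
      using norm_triangle_ineq4[of 1 "a * p ^ j"] by (simp add: norm_mult norm_power)
    also have "\<dots> \<le> 1 + R * norm p ^ j"
      using assms by (simp add: mult_right_mono)
    also have "\<dots> \<le> exp (R * norm p ^ j)" by (rule exp_ge_add_one_self)
    finally show "norm (1 - a * p ^ j) \<le> exp (R * norm p ^ j)" .
  qed simp
  also have "\<dots> = exp (R * (\<Sum>j<n. norm p ^ j))"
    by (simp add: exp_sum sum_distrib_left)
  also have "\<dots> \<le> exp (R * (1 / (1 - norm p)))"
  proof -
    have "(\<Sum>j<n. norm p ^ j) \<le> (\<Sum>j. norm p ^ j)"
      using assms(1) by (intro sum_le_suminf summable_geometric) auto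
    also have "\<dots> = 1 / (1 - norm p)"
      using assms(1) by (intro suminf_geometric) simp
    finally show ?thesis by (simp only: exp_le_cancel_iff mult_left_mono R)
  qed
  finally show ?thesis by simp
qed

lemma convergent_prod_qpoch:
  assumes "norm p < 1"
  shows "convergent_prod (\<lambda>j. 1 - a * p ^ j :: complex)"
proof (intro abs_convergent_prod_imp_convergent_prod summable_imp_abs_convergent_prod)
  show "summable (\<lambda>j. norm (1 - a * p ^ j - 1))"
    using assms by (auto simp: norm_mult norm_power intro!: summable_mult summable_geometric)
qed

lemma qpoch_tendsto:
  assumes "norm p < 1"
  shows "(\<lambda>n. qpoch a p n) \<longlonglongrightarrow> qpoch_inf a p"
  using convergent_prod_LIMSEQ[OF convergent_prod_qpoch[OF assms, of a]]
  unfolding qpoch_def qpoch_inf_def LIMSEQ_lessThan_iff_atMost .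

lemma qpoch_inf_split:
  assumes "norm p < 1"
  shows "qpoch_inf a p = qpoch a p n * qpoch_inf (a * p ^ n) p"
proof (rule LIMSEQ_unique)
  show "(\<lambda>m. qpoch a p (n + m)) \<longlonglongrightarrow> qpoch_inf a p"
    using LIMSEQ_ignore_initial_segment[OF qpoch_tendsto[OF assms], of a n]
    by (simp add: add.commute)
  show "(\<lambda>m. qpoch a p (n + m)) \<longlonglongrightarrow> qpoch a p n * qpoch_inf (a * p ^ n) p"
    unfolding qpoch_add by (intro tendsto_mult_left qpoch_tendsto assms)
qed

lemma qpoch_inf_shift:
  assumes "norm p < 1"
  shows "qpoch_inf a p = (1 - a) * qpoch_inf (a * p) p"
  using qpoch_inf_split[OF assms, of a 1] by (simp add: qpoch_Suc)

lemma qpoch_inf_one: "norm p < 1 \<Longrightarrow> qpoch_inf 1 p = 0"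
  using qpoch_inf_shift[of p 1] by simp

lemma qpoch_inf_nonzero:
  assumes "norm p < 1" "\<And>j. a * p ^ j \<noteq> 1"
  shows "qpoch_inf a p \<noteq> 0"
  unfolding qpoch_inf_def
  by (rule prodinf_nonzero[OF convergent_prod_qpoch[OF assms(1)]]) (use assms(2) in auto)

lemma norm_qpoch_inf_le:
  assumes "norm p < 1" "norm a \<le> R"
  shows "norm (qpoch_inf a p) \<le> exp (R / (1 - norm p))"
  by (rule LIMSEQ_le_const2[OF tendsto_norm[OF qpoch_tendsto[OF assms(1)]]])
     (use norm_qpoch_le[OF assms] in auto)

text \<open>Sorts the factors by the parity of the exponent of \<open>q\<close>; partial products of
  even length split exactly.\<close>

lemma qpoch_inf_bisect:
  assumes "norm q < 1"
  shows "qpoch_inf a q = qpoch_inf a (q\<^sup>2) * qpoch_inf (a * q) (q\<^sup>2)"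
proof (rule LIMSEQ_unique)
  have p: "norm (q\<^sup>2) < 1"
    using assms by (simp add: norm_power power_less_one_iff)
  have eq: "qpoch a q (2 * n) = qpoch a (q\<^sup>2) n * qpoch (a * q) (q\<^sup>2) n" for n
    by (induction n) (simp_all add: qpoch_Suc power_mult mult.assoc)
  have "strict_mono (\<lambda>n::nat. 2 * n)" by (simp add: strict_mono_def)
  then show "(\<lambda>n. qpoch a q (2 * n)) \<longlonglongrightarrow> qpoch_inf a q"
    using LIMSEQ_subseq_LIMSEQ[OF qpoch_tendsto[OF assms, of a]] by (simp add: o_def)
  show "(\<lambda>n. qpoch a q (2 * n)) \<longlonglongrightarrow> qpoch_inf a (q\<^sup>2) * qpoch_inf (a * q) (q\<^sup>2)"
    unfolding eq by (intro tendsto_mult qpoch_tendsto p)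
qed

text \<open>The partial products are polynomials in \<open>a\<close> and converge uniformly on discs
  of radius 1, by the Weierstrass test for \<open>a * p ^ n\<close>.\<close>

lemma holomorphic_qpoch_inf:
  assumes "norm p < 1"
  shows "(\<lambda>a. qpoch_inf a p) holomorphic_on UNIV"
proof (rule holomorphic_uniform_sequence)
  show "(\<lambda>a. qpoch a p n) holomorphic_on UNIV" for n
    unfolding qpoch_def by (intro holomorphic_intros)
  fix x :: complex
  have "uniformly_convergent_on (cball x 1) (\<lambda>N a. \<Prod>n<N. 1 + (- a * p ^ n))"
  proof (rule Infinite_Products.uniformly_convergent_on_prod)
    show "uniformly_convergent_on (cball x 1) (\<lambda>N a. \<Sum>n<N. norm (- a * p ^ n))"
    proof (rule Weierstrass_m_test'_ev)
      show "summable (\<lambda>n. (norm x + 1) * norm p ^ n)"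
        using assms by (intro summable_mult summable_geometric) auto
      have "norm a \<le> norm x + 1" if "a \<in> cball x 1" for a
        using that norm_triangle_ineq2[of a x] by (simp add: dist_norm norm_minus_commute)
      then show "\<forall>\<^sub>F n in sequentially. \<forall>a\<in>cball x 1.
                   norm (norm (- a * p ^ n)) \<le> (norm x + 1) * norm p ^ n"
        by (intro always_eventually allI ballI) (simp add: norm_mult norm_power mult_right_mono)
    qed
  qed (auto intro!: continuous_intros)
  then obtain L where L: "uniform_limit (cball x 1) (\<lambda>N a. qpoch a p N) L sequentially"
    by (auto simp: uniformly_convergent_on_def qpoch_def)
  \<comment> \<open>Uniform convergence only yields some limit \<open>L\<close>; uniqueness of
    pointwise limits identifies it.\<close>
  have "qpoch_inf a p = L a" if "a \<in> cball x 1" for a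
    using LIMSEQ_unique[OF qpoch_tendsto[OF assms] tendsto_uniform_limitI[OF L that]] .
  then have "uniform_limit (cball x 1) (\<lambda>N a. qpoch a p N) (\<lambda>a. qpoch_inf a p) sequentially
      \<longleftrightarrow> uniform_limit (cball x 1) (\<lambda>N a. qpoch a p N) L sequentially"
    by (intro uniform_limit_cong') auto
  with L have "uniform_limit (cball x 1) (\<lambda>N a. qpoch a p N) (\<lambda>a. qpoch_inf a p) sequentially"
    by blast
  then show "\<exists>d>0. cball x d \<subseteq> UNIV \<and>
      uniform_limit (cball x d) (\<lambda>N a. qpoch a p N) (\<lambda>a. qpoch_inf a p) sequentially"
    by (intro exI[of _ 1]) simp
qed simp

section \<open>A transformation of Fine's function\<close>

text \<open>\<open>(c p^j;p)_n\<close> is \<open>(c;p)_(j+n) / (c;p)_j\<close>, and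
  \<open>1 / (c;p)_n\<close> is bounded because it converges. Uniformity in \<open>j\<close> keeps
  the remainders of the iteration in \<open>fine_transformation\<close> under control.\<close>

lemma bounded_qpoch_quotient:
  assumes "norm p < 1" "\<And>j. c * p ^ j \<noteq> 1"
  obtains M where "\<And>n j. norm (qpoch b p n / qpoch (c * p ^ j) p n) \<le> M"
proof -
  have "(\<lambda>n. inverse (qpoch c p n)) \<longlonglongrightarrow> inverse (qpoch_inf c p)"
    by (intro tendsto_inverse qpoch_tendsto qpoch_inf_nonzero assms)
  then have "Bseq (\<lambda>n. inverse (qpoch c p n))" by (intro convergent_imp_Bseq convergentI)
  then obtain B where B: "\<And>n. norm (inverse (qpoch c p n)) \<le> B" "B > 0"
    by (auto simp: Bseq_def)
  let ?E = "\<lambda>a. exp (norm a / (1 - norm p))"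
  have "norm (qpoch b p n / qpoch (c * p ^ j) p n) \<le> ?E b * (?E c * B)" for n j
  proof -
    have eq: "qpoch b p n / qpoch (c * p ^ j) p n
            = qpoch b p n * (qpoch c p j * inverse (qpoch c p (j + n)))"
      using qpoch_nonzero[OF assms(2)] by (simp add: qpoch_add field_simps)
    show ?thesis
      unfolding eq norm_mult
      by (intro mult_mono norm_qpoch_le assms order_refl B) (auto simp: less_imp_le[OF B(2)])
  qed
  then show ?thesis by (rule that)
qed

text \<open>Iterating \<open>(1 - z) F(c, z) = 1 + z (c - b) / (1 - c) F(c p, z p)\<close> for
  \<open>F(c, z) = \<Sum>n. (b;p)\<^sub>n / (c;p)\<^sub>n z\<^sup>n\<close> gives a case of Jackson's transformation of a
  \<open>\<^sub>2\<phi>\<^sub>1\<close> into a \<open>\<^sub>2\<phi>\<^sub>2\<close>.\<close>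

lemma fine_transformation:
  fixes b c p z :: complex
  assumes p: "norm p < 1" and z: "norm z < 1" and c: "\<And>j. c * p ^ j \<noteq> 1"
  defines "u \<equiv> \<lambda>n. (\<Prod>j<n. z * p ^ j * (c * p ^ j - b)) / (qpoch c p n * qpoch z p (Suc n))"
  shows "summable (\<lambda>n. qpoch b p n / qpoch c p n * z ^ n)"
    and "u sums (\<Sum>n. qpoch b p n / qpoch c p n * z ^ n)"
proof -
  obtain M where M: "\<And>n j. norm (qpoch b p n / qpoch (c * p ^ j) p n) \<le> M"
    using bounded_qpoch_quotient[OF p c, where b = b] by blast
  \<comment> \<open>\<open>F j\<close> is Fine's function after \<open>j\<close> steps of the
    iteration, at \<open>(c p^j, z p^j)\<close>.\<close>
  define a where "a = (\<lambda>j n. qpoch b p n / qpoch (c * p ^ j) p n * (z * p ^ j) ^ n)"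
  define F where "F = (\<lambda>j. \<Sum>n. a j n)"
  have pj: "norm p ^ j \<le> 1" for j using p by (simp add: power_le_one)
  have zpj: "norm (z * p ^ j) \<le> norm z" for j
    using mult_left_le[OF pj[of j], of "norm z"] by (simp add: norm_mult norm_power)
  have z1: "z * p ^ j \<noteq> 1" for j using zpj[of j] z by auto
  have na: "norm (a j n) \<le> M * norm z ^ n" for j n
    unfolding a_def norm_mult norm_power
    using M[of n j] power_mono[OF zpj[of j] norm_ge_zero, of n]
    by (intro mult_mono) (auto simp: norm_mult norm_power intro: order_trans[OF norm_ge_zero])
  have sg: "summable (\<lambda>n. M * norm z ^ n)"
    using z by (intro summable_mult summable_geometric) auto
  have sa: "summable (a j)" for j
    by (rule summable_comparison_test'[OF sg na])
  have nF: "norm (F j) \<le> (\<Sum>n. M * norm z ^ n)" for j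
    unfolding F_def by (rule order_trans[OF summable_norm suminf_le])
      (use na sg summable_comparison_test'[OF sg, of 0 "\<lambda>n. norm (a j n)"] in auto)
  show "summable (\<lambda>n. qpoch b p n / qpoch c p n * z ^ n)"
    using sa[of 0] by (simp add: a_def[abs_def])
  have step: "(1 - z * p ^ j) * F j
      = 1 + z * p ^ j * (c * p ^ j - b) / (1 - c * p ^ j) * F (Suc j)" for j
  proof -
    define x where "x = z * p ^ j"
    define d where "d = c * p ^ j"
    have d: "d * p ^ n \<noteq> 1" for n
      using c[of "j + n"] by (simp add: d_def power_add mult.assoc)
    have d1: "d \<noteq> 1" using d[of 0] by simp
    \<comment> \<open>Over the common denominator \<open>(1 - d) (d p;p)_n\<close> the two terms
      differ through \<open>(1 - b p^n) - (1 - d p^n) = (d - b) p^n\<close>, and \<open>p^n\<close>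
      turns \<open>x^n\<close> into \<open>(x p)^n\<close>.\<close>
    have trm: "a j (Suc n) - x * a j n = x * (d - b) / (1 - d) * a (Suc j) n" for n
    proof -
      have nz: "qpoch d p n \<noteq> 0" "qpoch (d * p) p n \<noteq> 0" "1 - d * p ^ n \<noteq> 0"
        using qpoch_nonzero[of d p n] qpoch_nonzero[of "d * p" p n] d
          d[of "Suc _"] by (auto simp: mult.assoc)
      have eq: "qpoch d p n = (1 - d) * qpoch (d * p) p n / (1 - d * p ^ n)"
        using nz qpoch_Suc[of d p n] qpoch_Suc_shift[of d p n] by (simp add: field_simps)
      have 1: "a j (Suc n) = qpoch b p n * (1 - b * p ^ n) / ((1 - d) * qpoch (d * p) p n) * (x * x ^ n)"
        by (simp add: a_def x_def d_def qpoch_Suc[of b] qpoch_Suc_shift[of "c * p ^ j"])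
      have 2: "a j n = qpoch b p n * (1 - d * p ^ n) / ((1 - d) * qpoch (d * p) p n) * x ^ n"
        using nz d1 by (simp add: a_def x_def[symmetric] d_def[symmetric] eq)
      have 3: "a (Suc j) n = qpoch b p n / qpoch (d * p) p n * (x ^ n * p ^ n)"
        by (simp add: a_def x_def d_def mult_ac power_mult_distrib)
      show ?thesis unfolding 1 2 3 using nz d1 by (simp add: divide_simps) algebra
    qed
    have "F j = a j 0 + (\<Sum>n. a j (Suc n))"
      unfolding F_def using suminf_split_head[OF sa[of j]] by simp
    moreover have "(\<Sum>n. a j (Suc n)) - x * F j = (\<Sum>n. a j (Suc n) - x * a j n)"
      unfolding F_def
      using suminf_diff[of "\<lambda>n. a j (Suc n)" "\<lambda>n. x * a j n"] sa[of j] suminf_mult[OF sa[of j], of x]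
      by (simp add: summable_Suc_iff summable_mult)
    moreover have "\<dots> = x * (d - b) / (1 - d) * F (Suc j)"
      unfolding F_def trm by (intro suminf_mult sa)
    moreover have "a j 0 = 1" by (simp add: a_def)
    ultimately show ?thesis unfolding x_def[symmetric] d_def[symmetric]
      by (simp add: algebra_simps)
  qed
  have qz: "qpoch c p n \<noteq> 0" "qpoch z p n \<noteq> 0" for n
    using qpoch_nonzero[OF c] qpoch_nonzero[OF z1] by auto
  \<comment> \<open>The denominator of \<open>u N\<close> already contains
    \<open>1 - z * p ^ N\<close>, the divisor of the next use of \<open>step\<close>; the remainder
    multiplies it back.\<close>
  have iter: "F 0 = (\<Sum>n<N. u n) + u N * (1 - z * p ^ N) * F N" for N
  proof (induction N)
    case 0
    then show ?case using z1[of 0] by (simp add: u_def qpoch_Suc)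
  next
    case (Suc N)
    have nz: "1 - c * p ^ N \<noteq> 0" "1 - z * p ^ N \<noteq> 0" "1 - z * p ^ Suc N \<noteq> 0"
      using c[of N] z1[of N] z1[of "Suc N"] by auto
    have "u (Suc N) * (1 - z * p ^ Suc N) = u N * (z * p ^ N * (c * p ^ N - b) / (1 - c * p ^ N))"
      using nz qz[of N] unfolding u_def qpoch_Suc prod.lessThan_Suc by (simp add: divide_simps)
    then have "u N + u (Suc N) * (1 - z * p ^ Suc N) * F (Suc N)
      = u N * (1 + z * p ^ N * (c * p ^ N - b) / (1 - c * p ^ N) * F (Suc N))"
      by (simp only: distrib_left mult_1_right mult.assoc)
    also have "\<dots> = u N * (1 - z * p ^ N) * F N" using step[of N] by simp
    finally show ?case using Suc.IH by simp
  qed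
  have p0: "(\<lambda>n. p ^ n) \<longlonglongrightarrow> 0" by (rule LIMSEQ_power_zero[OF p])
  \<comment> \<open>\<open>r n\<close> is the multiplier from \<open>u n\<close> to
    \<open>u (Suc n)\<close>. Its factor \<open>p ^ n\<close> drives it to 0, so the ratio test
    applies.\<close>
  define r where "r = (\<lambda>n. z * p ^ n * (c * p ^ n - b) / ((1 - c * p ^ n) * (1 - z * p ^ Suc n)))"
  have "r \<longlonglongrightarrow> z * 0 * (c * 0 - b) / ((1 - c * 0) * (1 - z * 0))"
    unfolding r_def by (intro tendsto_intros p0 LIMSEQ_Suc[OF p0]) auto
  then have "(\<lambda>n. norm (r n)) \<longlonglongrightarrow> 0" by (simp add: tendsto_norm_zero)
  then have "\<forall>\<^sub>F n in sequentially. norm (r n) < 1 / 2" by (rule order_tendstoD) simp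
  then obtain N where N: "\<And>n. n \<ge> N \<Longrightarrow> norm (r n) < 1 / 2"
    by (auto simp: eventually_sequentially)
  have ur: "u (Suc n) = r n * u n" for n
    unfolding u_def r_def qpoch_Suc prod.lessThan_Suc by (simp only: times_divide_times_eq mult_ac)
  have "summable u"
  proof (rule summable_ratio_test[where c = "1 / 2" and N = N])
    show "norm (u (Suc n)) \<le> 1 / 2 * norm (u n)" if "n \<ge> N" for n
      unfolding ur norm_mult using mult_right_mono[OF less_imp_le[OF N[OF that]] norm_ge_zero] .
  qed simp
  then have u0: "u \<longlonglongrightarrow> 0" by (rule summable_LIMSEQ_zero)
  \<comment> \<open>The majorant in \<open>nF\<close> is the same for all \<open>j\<close>, so the
    remainder in \<open>iter\<close> vanishes together with \<open>u\<close>.\<close>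
  have "Bseq F" using nF by (intro BseqI') auto
  moreover have "(\<lambda>N. u N * (1 - z * p ^ N)) \<longlonglongrightarrow> 0 * (1 - z * 0)"
    by (intro tendsto_intros u0 p0)
  ultimately have "(\<lambda>N. u N * (1 - z * p ^ N) * F N) \<longlonglongrightarrow> 0"
    by (simp add: bounded_bilinear.Zfun_prod_Bfun[OF bounded_bilinear_mult] tendsto_Zfun_iff)
  then have "(\<lambda>N. F 0 - u N * (1 - z * p ^ N) * F N) \<longlonglongrightarrow> F 0 - 0"
    by (intro tendsto_diff tendsto_const)
  moreover have "(\<Sum>n<N. u n) = F 0 - u N * (1 - z * p ^ N) * F N" for N
    using iter[of N] by simp
  ultimately have "u sums F 0" by (simp add: sums_def)
  then show "u sums (\<Sum>n. qpoch b p n / qpoch c p n * z ^ n)"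
    by (simp add: F_def a_def)
qed

section \<open>Identity (1): \<open>kappa\<close> as a value of Fine's function\<close>

lemma power_Suc_square: "q ^ (Suc n)\<^sup>2 = q ^ n\<^sup>2 * q * (q\<^sup>2) ^ n" for q :: complex
proof -
  have "(Suc n)\<^sup>2 = n\<^sup>2 + 1 + 2 * n" by (simp add: power2_eq_square)
  then show ?thesis by (simp only: power_add power_mult power_one_right)
qed

text \<open>Fine's function with \<open>b = w p\<close>, \<open>c = w q p\<close>,
  \<open>z = q / w\<close>: the condition \<open>norm z < 1\<close> is
  \<open>norm w > norm q\<close>, and \<open>(z;p)_(n+1)\<close> becomes the second denominator of
  \<open>K1\<close>.\<close>

lemma kappa_eq_K1:
  fixes q w :: complex
  assumes q0: "q \<noteq> 0" and q: "norm q < 1" and w: "norm w > norm q"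
    and nz: "\<And>j. w * q * (q\<^sup>2) ^ j \<noteq> 1"
  shows "kappa w q = K1 w q"
proof -
  define p where "p = q\<^sup>2"
  define iw where "iw = inverse w"
  have w0: "w \<noteq> 0" using w by auto
  have wiw: "w * iw = 1" using w0 by (simp add: iw_def)
  have p: "norm p < 1"
    using q by (simp add: p_def norm_power power_less_one_iff)
  have z: "norm (q * iw) < 1"
    using w w0 by (simp add: iw_def norm_mult norm_inverse norm_divide field_simps)
  have c: "w * q * p * p ^ j \<noteq> 1" for j
    using nz[of "Suc j"] by (simp add: p_def mult.assoc)
  have wq: "1 - w * q \<noteq> 0" using nz[of 0] by simp
  define u where "u = (\<lambda>n. (\<Prod>j<n. q * iw * p ^ j * (w * q * p * p ^ j - w * p)) /
    (qpoch (w * q * p) p n * qpoch (q * iw) p (Suc n)))"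
  define v where "v = (\<lambda>n. qpoch (w * p) p n / qpoch (w * q * p) p n * (q * iw) ^ n)"
  have v: "summable v" and u: "u sums suminf v"
    unfolding u_def v_def using fine_transformation[OF p z c, of "w * p"] by auto
  \<comment> \<open>The \<open>j\<close>-th factor is \<open>- q^(2j+1) p (1 - q p^j)\<close>, and
    the odd numbers \<open>2j+1\<close> below \<open>2n\<close> add up to
    \<open>n^2\<close>.\<close>
  have num: "(\<Prod>j<n. q * iw * p ^ j * (w * q * p * p ^ j - w * p))
      = (-1) ^ n * q ^ n\<^sup>2 * p ^ n * qpoch q p n" for n
  proof (induction n)
    case (Suc n)
    have "q * iw * p ^ n * (w * q * p * p ^ n - w * p) = - (q * p * p ^ n * (1 - q * p ^ n))"
    proof -
      define P where "P = p ^ n"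
      show ?thesis unfolding P_def[symmetric] using wiw by algebra
    qed
    then show ?case using Suc.IH
      unfolding power_Suc_square p_def[symmetric] by (simp add: qpoch_Suc)
  qed simp
  have "kappa w q = (\<Sum>n. q / (1 - w * q) * v n)"
    unfolding kappa_def p_def[symmetric] iw_def[symmetric]
    by (rule suminf_cong) (simp add: v_def qpoch_Suc_shift power_mult_distrib)
  also have "\<dots> = q / (1 - w * q) * suminf v" by (rule suminf_mult[OF v])
  also have "\<dots> = (\<Sum>n. q / (1 - w * q) * u n)"
    by (rule sums_unique[OF sums_mult[OF u]])
  also have "\<dots> = K1 w q"
    unfolding K1_def p_def[symmetric] iw_def[symmetric]
  proof (rule suminf_cong)
    fix m
    have "q ^ (m + 1)\<^sup>2 = q ^ m\<^sup>2 * q * p ^ m"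
      using power_Suc_square[of q m] by (simp add: p_def)
    moreover have "qpoch (w * q) p (m + 1) = (1 - w * q) * qpoch (w * q * p) p m"
      by (simp add: qpoch_Suc_shift)
    ultimately show "q / (1 - w * q) * u m = (-1) ^ m * q ^ (m + 1)\<^sup>2 * qpoch q p m /
        (qpoch (w * q) p (m + 1) * qpoch (iw * q) p (m + 1))"
      unfolding u_def num by (simp add: mult_ac)
  qed
  finally show ?thesis .
qed

section \<open>Clearing the denominators of $K$ and $K_1$\<close>

text \<open>The common shape of both series, multiplied by the infinite products in \<open>x\<close>
  and \<open>y\<close>: denominators become tails, so nothing can vanish below. \<open>t\<close> is
  1 for \<open>K\<close> and \<open>q^2\<close> for \<open>K1\<close>, because
  \<open>q^((n+1)^2) = q q^(n^2) (q^2)^n\<close>.\<close>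

definition cleared_term :: "complex \<Rightarrow> complex \<Rightarrow> complex \<Rightarrow> complex \<Rightarrow> nat \<Rightarrow> complex" where
  "cleared_term q t x y n = (-1) ^ n * q ^ n\<^sup>2 * t ^ n * qpoch q (q\<^sup>2) n *
     (qpoch_inf (x * (q\<^sup>2) ^ n) (q\<^sup>2) * qpoch_inf (y * (q\<^sup>2) ^ n) (q\<^sup>2))"

definition cleared :: "complex \<Rightarrow> complex \<Rightarrow> complex \<Rightarrow> complex \<Rightarrow> complex" where
  "cleared q t x y = (\<Sum>n. cleared_term q t x y n)"

definition K_num :: "complex \<Rightarrow> complex \<Rightarrow> complex" where
  "K_num q w = cleared q 1 (w * q\<^sup>2) (inverse w * q\<^sup>2)"

text \<open>The denominators of \<open>K1\<close> have one factor more than its numerators, so the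
  parameters start at \<open>w q^3\<close> and \<open>q^3 / w\<close>; the factors
  \<open>1 - w q\<close> and \<open>1 - q / w\<close> return in \<open>K1_eq\<close>.\<close>

definition K1_num :: "complex \<Rightarrow> complex \<Rightarrow> complex" where
  "K1_num q w = q * cleared q (q\<^sup>2) (w * q * q\<^sup>2) (inverse w * q * q\<^sup>2)"

lemma K_num_inverse: "K_num q (inverse w) = K_num q w"
  by (simp add: K_num_def cleared_def cleared_term_def mult_ac)

lemma K1_num_inverse: "K1_num q (inverse w) = K1_num q w"
  by (simp add: K1_num_def cleared_def cleared_term_def mult_ac)

section \<open>Convergence and holomorphy of the cleared series\<close>

context
  fixes q p :: complex
  assumes q0: "q \<noteq> 0" and q: "norm q < 1"
  defines "p \<equiv> q\<^sup>2"
begin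

lemma norm_p: "norm p < 1"
  using q by (simp add: p_def norm_power power_less_one_iff)

lemma power_neq_1: "p ^ Suc n \<noteq> 1"
proof
  assume "p ^ Suc n = 1"
  then have "norm p ^ Suc n = 1" by (metis norm_one norm_power)
  then show False using norm_p power_Suc_less_one[of "norm p" n] by (cases "p = 0") auto
qed

text \<open>\<open>n \<le> n^2\<close> gives the geometric decay; all other factors are bounded
  uniformly for \<open>x\<close> and \<open>y\<close> in a disc.\<close>

lemma norm_cleared_term_le:
  assumes "norm t \<le> 1" "norm x \<le> R" "norm y \<le> R"
  shows "norm (cleared_term q t x y n)
      \<le> exp (norm q / (1 - norm p)) * (exp (R / (1 - norm p)) * exp (R / (1 - norm p))) * norm q ^ n"
proof -
  have le: "norm (a * p ^ n) \<le> R" if "norm a \<le> R" for a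
    using mult_mono[OF that, of "norm p ^ n" 1] norm_p order_trans[OF norm_ge_zero that]
    by (simp add: norm_mult norm_power power_le_one)
  have "norm ((-1) ^ n * q ^ n\<^sup>2) \<le> norm q ^ n"
    using q by (simp add: norm_mult norm_power power_decreasing power2_nat_le_imp_le self_le_power power2_eq_square)
  moreover have "norm (t ^ n) \<le> 1" using assms(1) by (simp add: norm_power power_le_one)
  moreover have "norm (qpoch q p n) \<le> exp (norm q / (1 - norm p))"
    by (rule norm_qpoch_le[OF norm_p order_refl])
  moreover have "norm (qpoch_inf (x * p ^ n) p) \<le> exp (R / (1 - norm p))"
    "norm (qpoch_inf (y * p ^ n) p) \<le> exp (R / (1 - norm p))"
    by (intro norm_qpoch_inf_le norm_p le assms)+
  ultimately have "norm (cleared_term q t x y n) \<le>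
      norm q ^ n * 1 * exp (norm q / (1 - norm p)) * (exp (R / (1 - norm p)) * exp (R / (1 - norm p)))"
    unfolding cleared_term_def p_def[symmetric] norm_mult[of _ "t ^ n"]
      norm_mult[of _ "qpoch q p n"] norm_mult[of _ "_ * _"] norm_mult[of "qpoch_inf _ _"]
    by (intro mult_mono) auto
  then show ?thesis by (simp add: mult_ac)
qed

lemma summable_bound: "summable (\<lambda>n. M * norm q ^ n)"
  using q by (intro summable_mult summable_geometric) auto

lemma summable_cleared_term: "norm t \<le> 1 \<Longrightarrow> summable (cleared_term q t x y)"
  by (rule summable_comparison_test'[OF summable_bound
        norm_cleared_term_le[where R = "max (norm x) (norm y)"]]) auto

lemma holomorphic_cleared:
  assumes "norm t \<le> 1"
  shows "(\<lambda>w. cleared q t (w * a) (inverse w * b)) holomorphic_on - {0}"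
proof (rule holomorphic_uniform_sequence)
  have hE: "(\<lambda>w. qpoch_inf (f w) p) holomorphic_on - {0}" if "f holomorphic_on - {0}" for f
    using holomorphic_on_compose_gen[OF that holomorphic_qpoch_inf[OF norm_p]] by (simp add: o_def)
  show "(\<lambda>w. \<Sum>n<N. cleared_term q t (w * a) (inverse w * b) n) holomorphic_on - {0}" for N
    unfolding cleared_term_def p_def[symmetric] by (intro holomorphic_intros hE) auto
  fix x :: complex assume "x \<in> - {0}"
  then have x: "norm x > 0" by simp
  \<comment> \<open>On the disc of radius \<open>norm x / 2\<close> about \<open>x\<close>,
    \<open>norm w\<close> lies between \<open>norm x / 2\<close> and \<open>2 * norm x\<close>; the
    two entries bound \<open>w * a\<close> and \<open>inverse w * b\<close>.\<close>
  define R where "R = max (2 * norm x * norm a) (norm b / (norm x / 2))"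
  have bds: "norm (w * a) \<le> R \<and> norm (inverse w * b) \<le> R \<and> w \<noteq> 0"
    if "w \<in> cball x (norm x / 2)" for w
  proof -
    have d: "norm (x - w) \<le> norm x / 2" using that by (simp add: dist_norm)
    have u: "norm w \<le> 2 * norm x"
      using d norm_triangle_ineq2[of w x] x norm_minus_commute[of w x] by linarith
    have l: "norm x / 2 \<le> norm w" using d norm_triangle_ineq2[of x w] by linarith
    have "norm (w * a) \<le> 2 * norm x * norm a"
      unfolding norm_mult by (intro mult_right_mono u) auto
    moreover have "norm (inverse w * b) \<le> norm b / (norm x / 2)"
      unfolding norm_mult norm_inverse
      using frac_le[OF norm_ge_zero order_refl _ l, of b] x by (simp add: field_simps)
    ultimately show ?thesis using l x unfolding R_def by (auto simp: le_max_iff_disj)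
  qed
  have "uniform_limit (cball x (norm x / 2))
      (\<lambda>N w. \<Sum>n<N. cleared_term q t (w * a) (inverse w * b) n)
      (\<lambda>w. \<Sum>n. cleared_term q t (w * a) (inverse w * b) n) sequentially"
    by (rule Weierstrass_m_test[OF norm_cleared_term_le[OF assms] summable_bound])
       (use bds in auto)
  then show "\<exists>d>0. cball x d \<subseteq> - {0} \<and> uniform_limit (cball x d)
      (\<lambda>N w. \<Sum>n<N. cleared_term q t (w * a) (inverse w * b) n)
      (\<lambda>w. cleared q t (w * a) (inverse w * b)) sequentially"
    using x bds unfolding cleared_def by (intro exI[of _ "norm x / 2"]) auto
qed (simp add: open_Compl)

lemma cleared_term_eq:
  assumes x: "\<And>j. x * p ^ j \<noteq> 1" and y: "\<And>j. y * p ^ j \<noteq> 1"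
  shows "(-1) ^ n * q ^ n\<^sup>2 * t ^ n * qpoch q p n / (qpoch x p n * qpoch y p n)
      = cleared_term q t x y n / (qpoch_inf x p * qpoch_inf y p)"
  using qpoch_inf_split[OF norm_p, of x n] qpoch_inf_split[OF norm_p, of y n]
    qpoch_inf_nonzero[OF norm_p x] qpoch_inf_nonzero[OF norm_p y]
  by (auto simp: cleared_term_def p_def[symmetric])

lemma cleared_eq:
  assumes x: "\<And>j. x * p ^ j \<noteq> 1" and y: "\<And>j. y * p ^ j \<noteq> 1" and t: "norm t \<le> 1"
  shows "(\<Sum>n. (-1) ^ n * q ^ n\<^sup>2 * t ^ n * qpoch q p n / (qpoch x p n * qpoch y p n))
      = cleared q t x y / (qpoch_inf x p * qpoch_inf y p)"
  unfolding cleared_term_eq[OF x y] cleared_def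
  by (simp add: suminf_divide summable_cleared_term[OF t])

lemma K_eq:
  assumes "\<And>j. w * p ^ Suc j \<noteq> 1" "\<And>j. inverse w * p ^ Suc j \<noteq> 1"
  shows "K w q = K_num q w / (qpoch_inf (w * p) p * qpoch_inf (inverse w * p) p)"
  unfolding K_def K_num_def p_def[symmetric]
  using cleared_eq[of "w * p" "inverse w * p" 1] assms by (simp add: mult_ac)

lemma K1_eq:
  assumes x: "\<And>j. w * q * p ^ j \<noteq> 1" and y: "\<And>j. inverse w * q * p ^ j \<noteq> 1"
  shows "K1 w q = K1_num q w / (qpoch_inf (w * q) p * qpoch_inf (inverse w * q) p)"
proof -
  have xy: "w * q * p * p ^ j \<noteq> 1" "inverse w * q * p * p ^ j \<noteq> 1" for j
    using x[of "Suc j"] y[of "Suc j"] by (simp_all add: mult.assoc)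
  have tp: "norm p \<le> 1" using norm_p by simp
  define D where "D = (1 - w * q) * (1 - inverse w * q)"
  define c where "c = (\<lambda>n. (-1) ^ n * q ^ n\<^sup>2 * p ^ n * qpoch q p n /
    (qpoch (w * q * p) p n * qpoch (inverse w * q * p) p n))"
  have c: "c = (\<lambda>n. cleared_term q p (w * q * p) (inverse w * q * p) n /
      (qpoch_inf (w * q * p) p * qpoch_inf (inverse w * q * p) p))"
    unfolding c_def cleared_term_eq[OF xy] ..
  have "K1 w q = (\<Sum>n. q / D * c n)"
    unfolding K1_def p_def[symmetric]
    by (rule suminf_cong)
       (simp add: c_def D_def mult_ac qpoch_Suc_shift power_Suc_square[of q, folded p_def])
  also have "\<dots> = q / D * suminf c"
    unfolding c by (intro suminf_mult summable_divide summable_cleared_term tp)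
  also have "suminf c = cleared q p (w * q * p) (inverse w * q * p) /
      (qpoch_inf (w * q * p) p * qpoch_inf (inverse w * q * p) p)"
    unfolding c_def by (rule cleared_eq[OF xy tp])
  finally show ?thesis
    unfolding K1_num_def D_def p_def[symmetric]
      qpoch_inf_shift[OF norm_p, of "w * q"] qpoch_inf_shift[OF norm_p, of "inverse w * q"]
    by (simp add: mult_ac)
qed

section \<open>Functional equations under \<open>w -> q w\<close>\<close>

lemma K1_num_shift:
  assumes w: "w \<noteq> 0"
  shows "(1 - w * q) * K1_num q (q * w)
      = q * w * (K_num q w - qpoch_inf (w * p) p * qpoch_inf (inverse w) p)"
proof -
  define iw where "iw = inverse w"
  have wiw: "w * iw = 1" using w by (simp add: iw_def)
  \<comment> \<open>This is \<open>(w - p^n)\<close> times the \<open>n\<close>-th term of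
    \<open>K_num q w\<close>: lowering \<open>p / w\<close> to \<open>1 / w\<close> adds the factor
    \<open>1 - p^n / w\<close>. It tends to 0, so only \<open>- s 0\<close> survives the
    telescoping.\<close>
  define s where "s = (\<lambda>n. w * cleared_term q 1 (w * p) iw n)"
  define T where "T = cleared_term q 1 (w * p) (iw * p)"
  define T' where "T' = cleared_term q p (w * p * p) (iw * p)"
  have T: "summable T" and T': "summable T'"
    unfolding T_def T'_def using norm_p by (intro summable_cleared_term; simp)+
  have tele: "s (Suc n) - s n = (1 - w * q) * T' n - w * T n" for n
  proof -
    define X where "X = qpoch_inf (w * p * p * p ^ n) p"
    define Y where "Y = qpoch_inf (iw * p * p ^ n) p"
    define C where "C = (-1) ^ n * q ^ n\<^sup>2 * qpoch q p n"
    define P where "P = p ^ n"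
    have X: "qpoch_inf (w * p * P) p = (1 - w * p * P) * X"
      using qpoch_inf_shift[OF norm_p, of "w * p * P"] by (simp add: X_def P_def mult_ac)
    have Y: "qpoch_inf (iw * P) p = (1 - iw * P) * Y"
      using qpoch_inf_shift[OF norm_p, of "iw * P"] by (simp add: Y_def P_def mult_ac)
    have "s n = w * (C * ((1 - w * p * P) * X * ((1 - iw * P) * Y)))"
      unfolding s_def cleared_term_def p_def[symmetric] P_def[symmetric] X Y
      by (simp add: C_def P_def)
    moreover have "s (Suc n) = w * (- (C * q * P * (1 - q * P)) * (X * Y))"
      unfolding s_def cleared_term_def power_Suc_square qpoch_Suc p_def[symmetric]
      by (simp add: C_def P_def X_def Y_def mult_ac)
    moreover have "T n = C * ((1 - w * p * P) * X * Y)"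
      unfolding T_def cleared_term_def p_def[symmetric] P_def[symmetric] X
      by (simp add: C_def P_def Y_def)
    moreover have "T' n = C * P * (X * Y)"
      unfolding T'_def cleared_term_def p_def[symmetric]
      by (simp add: C_def P_def Y_def X_def mult_ac)
    \<comment> \<open>The claim \<open>tele\<close> with the common factor \<open>C * X * Y\<close>
      taken out.\<close>
    moreover have "w * (- (q * P * (1 - q * P))) - w * ((1 - w * p * P) * (1 - iw * P))
        = (1 - w * q) * P - w * (1 - w * p * P)"
      using wiw p_def by algebra
    ultimately show ?thesis by algebra
  qed
  have "s \<longlonglongrightarrow> w * 0"
    unfolding s_def by (intro tendsto_mult_left summable_LIMSEQ_zero summable_cleared_term) simp
  then have "(\<lambda>n. s (Suc n) - s n) sums (0 - s 0)" by (intro telescope_sums) simp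
  moreover have "(\<lambda>n. s (Suc n) - s n) sums ((1 - w * q) * suminf T' - w * suminf T)"
    unfolding tele by (intro sums_diff sums_mult summable_sums T T')
  ultimately have "(1 - w * q) * suminf T' - w * suminf T = - s 0"
    using sums_unique2 by fastforce
  moreover have "s 0 = w * (qpoch_inf (w * p) p * qpoch_inf iw p)"
    by (simp add: s_def cleared_term_def p_def)
  moreover have "K1_num q (q * w) = q * suminf T'"
  proof -
    have "q * w * q * p = w * p * p" "inverse (q * w) * q * p = iw * p"
      using q0 by (simp_all add: p_def power2_eq_square iw_def)
    note eqs = this
    show ?thesis
      unfolding K1_num_def p_def[symmetric] eqs T'_def cleared_def ..
  qed
  moreover have "K_num q w = suminf T"
    by (simp add: K_num_def T_def cleared_def p_def iw_def)
  ultimately show ?thesis unfolding iw_def[symmetric] by algebra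
qed

text \<open>This is \<open>K1_num_shift\<close> at \<open>1 / (q w)\<close>, where the inversion
  symmetry turns the arguments \<open>1 / w\<close> and \<open>1 / (q w)\<close> back into
  \<open>w\<close> and \<open>q w\<close>.\<close>

lemma K_num_shift:
  assumes w: "w \<noteq> 0"
  shows "(w - 1) * K1_num q w
      = K_num q (q * w) - qpoch_inf (inverse w * q) p * qpoch_inf (w * q) p"
proof -
  have 1: "inverse (q * w) * q = inverse w" "q * inverse (q * w) = inverse w"
    "inverse (q * w) * p = inverse w * q" "q * w = w * q"
    using q0 by (simp_all add: p_def power2_eq_square)
  have "(1 - inverse w) * K1_num q w
      = inverse w * (K_num q (q * w) - qpoch_inf (inverse w * q) p * qpoch_inf (w * q) p)"
    using K1_num_shift[of "inverse (q * w)"] q0 w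
    unfolding 1(1-3) K_num_inverse K1_num_inverse by (simp add: mult.commute[of q w])
  moreover have "w * inverse w = 1" using w by simp
  ultimately show ?thesis by algebra
qed

section \<open>A combination invariant under \<open>w -> q w\<close>\<close>

text \<open>The coefficients are theta functions that \<open>w -> q w\<close> exchanges up to
  elementary factors, matching the exchange of \<open>K_num\<close> and \<open>K1_num\<close> in the
  shift relations.\<close>

definition theta_comb :: "complex \<Rightarrow> complex" where
  "theta_comb w = qpoch_inf (w * q) p * qpoch_inf (inverse w * q) p * K_num q w
       - qpoch_inf w p * qpoch_inf (inverse w) p * K1_num q w"

lemma theta_comb_inverse: "theta_comb (inverse w) = theta_comb w"
  by (simp add: theta_comb_def K_num_inverse K1_num_inverse mult_ac)

lemma theta_comb_shift:
  assumes w: "w \<noteq> 0"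
  shows "theta_comb (q * w) = theta_comb w"
proof -
  define iw where "iw = inverse w"
  have wiw: "w * iw = 1" using w by (simp add: iw_def)
  define iq where "iq = inverse q"
  have qiq: "q * iq = 1" using q0 by (simp add: iq_def)
  define A where "A = qpoch_inf (w * p) p"
  define B where "B = qpoch_inf iw p"
  define C where "C = qpoch_inf (w * q) p"
  define D where "D = qpoch_inf (iw * q) p"
  have eqs: "q * w * q = w * p" "inverse (q * w) * q = iw" "inverse (q * w) = iw * iq"
    "iw * iq * p = iw * q" "q * w = w * q"
    using q0 by (simp_all add: p_def power2_eq_square iw_def iq_def)
  have "theta_comb (q * w) = A * B * K_num q (q * w) - C * ((1 - iw * iq) * D) * K1_num q (q * w)"
    unfolding theta_comb_def eqs(1,2) unfolding eqs(3) qpoch_inf_shift[OF norm_p, of "iw * iq"] eqs(4)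
    by (simp add: A_def B_def C_def D_def mult.commute[of q w])
  moreover have "theta_comb w = C * D * K_num q w - (1 - w) * A * B * K1_num q w"
    unfolding theta_comb_def qpoch_inf_shift[OF norm_p, of w]
    by (simp add: A_def B_def C_def D_def iw_def)
  moreover have "(1 - w * q) * K1_num q (q * w) = q * w * (K_num q w - A * B)"
    using K1_num_shift[OF w] by (simp add: A_def B_def iw_def)
  moreover have "(w - 1) * K1_num q w = K_num q (q * w) - D * C"
    using K_num_shift[OF w] by (simp add: C_def D_def iw_def)
  \<comment> \<open>Since \<open>1 - 1/(q w) = - (1 - w q)/(q w)\<close>, the shift relations apply
    without dividing by \<open>1 - w q\<close>, which may vanish. Their inhomogeneous parts
    contribute \<open>A B C D\<close> with opposite signs.\<close>
  ultimately show ?thesis using wiw qiq by algebra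
qed

lemma holomorphic_theta_comb: "theta_comb holomorphic_on - {0}"
proof -
  have hE: "(\<lambda>w. qpoch_inf (f w) p) holomorphic_on - {0}" if "f holomorphic_on - {0}" for f
    using holomorphic_on_compose_gen[OF that holomorphic_qpoch_inf[OF norm_p]] by (simp add: o_def)
  have hK: "K_num q holomorphic_on - {0}"
    unfolding K_num_def p_def[symmetric] by (rule holomorphic_cleared) simp
  have hK1: "K1_num q holomorphic_on - {0}"
    unfolding K1_num_def p_def[symmetric] mult.assoc
    using norm_p by (intro holomorphic_intros holomorphic_cleared) simp
  show ?thesis unfolding theta_comb_def by (intro holomorphic_intros hE hK hK1) auto
qed

text \<open>\<open>theta_comb\<close> lives on the compact torus \<open>(\<complex> - {0}) / q\<^bsup>\<int>\<^esup>\<close>, so it attains its maximum modulus.\<close>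

lemma theta_comb_constant:
  assumes w: "w \<noteq> 0"
  shows "theta_comb w = theta_comb 1"
proof -
  \<comment> \<open>A closed annulus that meets every orbit of \<open>w -> q w\<close>.\<close>
  define A where "A = {z :: complex. norm q \<le> norm z \<and> norm z \<le> 1}"
  have A0: "A \<subseteq> - {0}" using q0 by (auto simp: A_def)
  have "A = cball 0 1 - ball 0 (norm q)" by (auto simp: A_def)
  then have "compact A" by (simp add: compact_diff)
  moreover have "1 \<in> A" using q by (simp add: A_def)
  moreover have "continuous_on A (\<lambda>z. norm (theta_comb z))"
    by (intro continuous_on_norm holomorphic_on_imp_continuous_on holomorphic_on_subset[OF holomorphic_theta_comb A0])
  ultimately obtain x where x: "x \<in> A" "\<And>z. z \<in> A \<Longrightarrow> norm (theta_comb z) \<le> norm (theta_comb x)"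
    using continuous_attains_sup[of A "\<lambda>z. norm (theta_comb z)"] by auto
  have outer: "norm (theta_comb z) \<le> norm (theta_comb x)" if z: "norm z \<ge> 1" for z
  proof -
    have gp: "theta_comb (q ^ n * z) = theta_comb z" for n
    proof (induction n)
      case (Suc n)
      have "theta_comb (q * (q ^ n * z)) = theta_comb (q ^ n * z)" using z q0 by (intro theta_comb_shift) auto
      then show ?case using Suc by (simp add: mult.assoc)
    qed simp
    have "(\<lambda>n. norm (q ^ n * z)) \<longlonglongrightarrow> norm (0 * z)"
      using q by (intro tendsto_intros LIMSEQ_power_zero) auto
    then have "\<forall>\<^sub>F n in sequentially. norm (q ^ n * z) < 1"
      by (rule order_tendstoD) simp
    then have ex: "\<exists>n. norm (q ^ n * z) \<le> 1"
      by (auto simp: eventually_sequentially intro: less_imp_le)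
    \<comment> \<open>The least such \<open>n\<close> does not overshoot: the previous point has
      norm above 1, so \<open>norm (q ^ n * z)\<close> is at least \<open>norm q\<close>.\<close>
    define n where "n = (LEAST n. norm (q ^ n * z) \<le> 1)"
    have n: "norm (q ^ n * z) \<le> 1" unfolding n_def by (rule LeastI_ex[OF ex])
    have "norm q \<le> norm (q ^ n * z)"
    proof (cases n)
      case 0
      then show ?thesis using z q by simp
    next
      case (Suc m)
      then have "1 < norm (q ^ m * z)"
        using not_less_Least[of m "\<lambda>n. norm (q ^ n * z) \<le> 1"] by (simp add: n_def)
      then show ?thesis
        using Suc mult_left_mono[of 1 "norm (q ^ m * z)" "norm q"] by (simp add: norm_mult mult_ac)
    qed
    with n have "q ^ n * z \<in> A" by (simp add: A_def)
    from x(2)[OF this] show ?thesis by (simp add: gp)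
  qed
  have "norm (theta_comb z) \<le> norm (theta_comb x)" if z: "z \<in> - {0}" for z
  proof (cases "norm z \<ge> 1")
    case False
    then have "norm (inverse z) \<ge> 1" using z by (simp add: norm_inverse one_le_inverse)
    from outer[OF this] show ?thesis by (simp add: theta_comb_inverse)
  qed (rule outer)
  \<comment> \<open>Inversion has covered \<open>norm z < 1\<close>, so \<open>x\<close> is a
    maximum of the modulus over the whole connected open punctured plane.\<close>
  then have "theta_comb constant_on - {0}"
    using x(1) A0 connected_punctured_universe[of "0 :: complex"]
    by (intro maximum_modulus_principle[OF holomorphic_theta_comb, of "- {0}" x]) auto
  then show ?thesis using w by (auto simp: constant_on_def)
qed

section \<open>The value at \<open>w = 1\<close> and identity (2)\<close>

text \<open>The series for \<open>K(1;q)\<close> would come from \<open>b = q\<close>,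
  \<open>c = p\<close>, \<open>z = 1\<close>, outside \<open>norm z < 1\<close>. One step later, at
  \<open>c = p^2\<close>, \<open>z = p\<close>, the transformation applies, and there Fine's series
  telescopes through \<open>(q;p)_n / (p;p)_n\<close>.\<close>

lemma K_num_one: "K_num q 1 = qpoch_inf q p * qpoch_inf p p"
proof -
  have nz: "p * p ^ j \<noteq> 1" "p * p * p ^ j \<noteq> 1" for j
    using power_neq_1[of j] power_neq_1[of "Suc j"] by (simp_all add: mult.assoc)
  have p1: "1 - p \<noteq> 0" using nz(1)[of 0] by simp
  define v where "v = (\<lambda>n. (-1) ^ n * q ^ n\<^sup>2 * 1 ^ n * qpoch q p n / (qpoch p p n * qpoch p p n))"
  define a where "a = (\<lambda>n. qpoch q p n / qpoch p p n)"
  define b where "b = (\<lambda>n. qpoch q p n / qpoch (p * p) p n * p ^ n)"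
  define u where "u = (\<lambda>n. (\<Prod>j<n. p * p ^ j * (p * p * p ^ j - q)) /
    (qpoch (p * p) p n * qpoch p p (Suc n)))"
  have sb: "summable b" and u: "u sums suminf b"
    unfolding u_def b_def using fine_transformation[OF norm_p norm_p nz(2), of q] by auto
  have qz: "qpoch p p n \<noteq> 0" "qpoch (p * p) p n \<noteq> 0" for n
    by (intro qpoch_nonzero nz)+
  have "a \<longlonglongrightarrow> qpoch_inf q p / qpoch_inf p p"
    unfolding a_def by (intro tendsto_divide qpoch_tendsto norm_p qpoch_inf_nonzero nz)
  then have "(\<lambda>n. a (Suc n) - a n) sums (qpoch_inf q p / qpoch_inf p p - a 0)"
    by (rule telescope_sums)
  moreover have "a (Suc n) - a n = (p - q) / (1 - p) * b n" for n
  proof -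
    have nz': "1 - p * p ^ n \<noteq> 0" using nz(1)[of n] by simp
    have s: "qpoch p p n = (1 - p) * qpoch (p * p) p n / (1 - p * p ^ n)"
      using nz' qpoch_Suc[of p p n] qpoch_Suc_shift[of p p n] by (simp add: field_simps)
    have "a (Suc n) = qpoch q p n * (1 - q * p ^ n) / ((1 - p) * qpoch (p * p) p n)"
      by (simp add: a_def qpoch_Suc[of q] qpoch_Suc_shift[of p])
    moreover have "a n = qpoch q p n * (1 - p * p ^ n) / ((1 - p) * qpoch (p * p) p n)"
      unfolding a_def s using nz' by simp
    ultimately show ?thesis
      unfolding b_def by (simp add: diff_divide_distrib[symmetric] algebra_simps)
  qed
  ultimately have "(\<lambda>n. (p - q) / (1 - p) * b n) sums (qpoch_inf q p / qpoch_inf p p - 1)"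
    by (simp add: a_def)
  then have lim: "(p - q) / (1 - p) * suminf b = qpoch_inf q p / qpoch_inf p p - 1"
    using sums_mult[OF summable_sums[OF sb], of "(p - q) / (1 - p)"] sums_unique2 by blast
  \<comment> \<open>\<open>p - q\<close> is the factor of the product for \<open>j = -1\<close>; it
    supplies the index shift from \<open>u n\<close> to \<open>v (Suc n)\<close>.\<close>
  have num: "(p - q) * (\<Prod>j<n. p * p ^ j * (p * p * p ^ j - q))
      = (-1) ^ Suc n * q ^ (Suc n)\<^sup>2 * qpoch q p (Suc n)" for n
  proof (induction n)
    case 0
    show ?case by (simp add: qpoch_Suc p_def power2_eq_square algebra_simps)
  next
    case (Suc n)
    have "p * p ^ n * (p * p * p ^ n - q) = - (q * p ^ Suc n * (1 - q * p ^ Suc n))"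
    proof -
      define P where "P = p ^ n"
      show ?thesis unfolding power_Suc P_def[symmetric] using p_def by algebra
    qed
    then show ?case
      using Suc.IH
      unfolding power_Suc_square[of q "Suc n", folded p_def] qpoch_Suc[of q p "Suc n"] prod.lessThan_Suc
      by (simp add: mult.assoc[symmetric])
  qed
  have "v (Suc n) = (p - q) / (1 - p) * u n" for n
    unfolding v_def u_def
    by (simp add: num[symmetric] qpoch_Suc_shift[of p] del: power_Suc)
  moreover have "(\<lambda>n. (p - q) / (1 - p) * u n) sums (qpoch_inf q p / qpoch_inf p p - 1)"
    using sums_mult[OF u, of "(p - q) / (1 - p)"] unfolding lim .
  ultimately have "(\<lambda>n. v (Suc n)) sums (qpoch_inf q p / qpoch_inf p p - 1)" by simp
  \<comment> \<open>\<open>v 0 = 1\<close> cancels the \<open>- 1\<close> left by the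
    telescoping.\<close>
  then have "v sums (qpoch_inf q p / qpoch_inf p p - 1 + v 0)" by (simp add: sums_Suc_iff)
  then have "suminf v = qpoch_inf q p / qpoch_inf p p"
    using sums_unique by (fastforce simp: v_def)
  moreover have "suminf v = cleared q 1 p p / (qpoch_inf p p * qpoch_inf p p)"
    unfolding v_def by (rule cleared_eq[OF nz(1) nz(1)]) simp
  moreover have "qpoch_inf p p \<noteq> 0" by (intro qpoch_inf_nonzero norm_p nz)
  ultimately show ?thesis by (simp add: K_num_def p_def[symmetric] field_simps)
qed

lemma K1_eq_K:
  assumes w: "w \<noteq> 0" and nz: "\<And>k. w * q ^ k \<noteq> 1" "\<And>k. inverse w * q ^ k \<noteq> 1"
  shows "K1 w q = - (w / (1 - w)\<^sup>2) * (K w q - qpoch_inf q p ^ 3 * qpoch_inf p p /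
           (qpoch_inf (w * q) q * qpoch_inf (inverse w * q) q))"
proof -
  have odd: "x * q * p ^ j = x * q ^ Suc (2 * j)" and even: "x * p ^ Suc j = x * q ^ (2 * Suc j)" for x j
    by (simp_all only: p_def power_mult power_Suc mult.assoc)
  have nz': "x * q * p ^ j \<noteq> 1" "x * p ^ Suc j \<noteq> 1" if "\<And>k. x * q ^ k \<noteq> 1" for x j
    using that unfolding odd even by blast+
  have E: "qpoch_inf (x * q) p \<noteq> 0" "qpoch_inf (x * p) p \<noteq> 0" if x: "\<And>k. x * q ^ k \<noteq> 1" for x
    using qpoch_inf_nonzero[OF norm_p, of "x * q"] qpoch_inf_nonzero[OF norm_p, of "x * p"] nz'[OF x]
    by (auto simp: mult.assoc)
  define A where "A = qpoch_inf (w * p) p"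
  define B where "B = qpoch_inf (inverse w * p) p"
  define C where "C = qpoch_inf (w * q) p"
  define D where "D = qpoch_inf (inverse w * q) p"
  define G where "G = qpoch_inf q p ^ 3 * qpoch_inf p p"
  have K: "K w q = K_num q w / (A * B)"
    unfolding A_def B_def by (intro K_eq nz' nz)
  have K1: "K1 w q = K1_num q w / (C * D)"
    unfolding C_def D_def by (intro K1_eq nz' nz)
  have ABCD: "A \<noteq> 0" "B \<noteq> 0" "C \<noteq> 0" "D \<noteq> 0"
    unfolding A_def B_def C_def D_def by (intro E nz)+
  have w1: "1 - w \<noteq> 0" using nz(1)[of 0] by simp
  have pq: "x * q * q = x * p" for x by (simp add: p_def power2_eq_square)
  have bis: "qpoch_inf (w * q) q = C * A" "qpoch_inf (inverse w * q) q = D * B"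
    unfolding qpoch_inf_bisect[OF q] p_def[symmetric] pq A_def B_def C_def D_def by simp_all
  have "theta_comb w = C * D * K_num q w - (1 - w) * A * ((1 - inverse w) * B) * K1_num q w"
    unfolding theta_comb_def qpoch_inf_shift[OF norm_p, of w] qpoch_inf_shift[OF norm_p, of "inverse w"]
    by (simp add: A_def B_def C_def D_def)
  \<comment> \<open>At \<open>w = 1\<close> the coefficient of \<open>K1_num\<close> contains
    \<open>(1;p)_inf = 0\<close>, so only the \<open>K_num\<close> part remains.\<close>
  moreover have "theta_comb w = G"
    unfolding theta_comb_constant[OF w] unfolding theta_comb_def G_def
    by (simp add: qpoch_inf_one[OF norm_p] K_num_one power3_eq_cube)
  \<comment> \<open>The sign changes because \<open>(1 - w) (1 - 1/w) = - (1 - w)^2 / w\<close>.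
    Division by \<open>A B C D\<close>, which by \<open>bis\<close> is the product in the claim,
    then gives the result.\<close>
  ultimately have "C * D * K_num q w + (1 - w)\<^sup>2 / w * (A * B) * K1_num q w = G"
    using w by (simp add: field_simps power2_eq_square)
  then have "w * (C * D * K_num q w) + (1 - w)\<^sup>2 * (A * B) * K1_num q w = w * G"
    using w by (simp add: field_simps)
  then show ?thesis
    unfolding bis K K1 G_def[symmetric] using ABCD w1 by (simp add: divide_simps) algebra
qed

end

theorem theorem5p1:
  fixes q :: complex
  assumes "0 < norm q" and "norm q < 1"
  shows "(\<forall>w::complex. norm w > norm q \<and> (\<forall>l::int. w \<noteq> q powi (2 * l + 1)) \<longrightarrow>
            kappa w q = K1 w q) \<and>
         (\<forall>w::complex. w \<noteq> 0 \<and> (\<forall>l::int. w \<noteq> q powi l) \<longrightarrow>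
            K1 w q = - (w / (1 - w)\<^sup>2) *
              (K w q - qpoch_inf q (q\<^sup>2) ^ 3 * qpoch_inf (q\<^sup>2) (q\<^sup>2) /
                       (qpoch_inf (w * q) q * qpoch_inf (inverse w * q) q)))"
proof -
  have q0: "q \<noteq> 0" using assms(1) by auto
  \<comment> \<open>\<open>neg\<close> and \<open>pos\<close> translate vanishing factors into
    negative and nonnegative exponents \<open>l\<close>.\<close>
  have neg: "w = q powi (- int k)" if "w * q ^ k = 1" for w k
    using that q0 by (simp add: power_int_minus field_simps)
  have pos: "w = q powi (int k)" if "inverse w * q ^ k = 1" for w k
    using that q0 by (cases "w = 0") (simp_all add: field_simps)
  have "kappa w q = K1 w q" if w: "norm w > norm q" "\<forall>l::int. w \<noteq> q powi (2 * l + 1)" for w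
  proof (rule kappa_eq_K1[OF q0 assms(2) w(1)])
    fix j
    \<comment> \<open>The exponent \<open>-(2j+1)\<close> is \<open>2 l + 1\<close> for
      \<open>l = -j - 1\<close>.\<close>
    have "w * q ^ (2 * j + 1) \<noteq> 1"
      using neg[of w "2 * j + 1"] w(2)[rule_format, of "- int j - 1"] by auto
    then show "w * q * (q\<^sup>2) ^ j \<noteq> 1" by (simp add: power_mult mult.assoc)
  qed
  moreover have "K1 w q = - (w / (1 - w)\<^sup>2) *
      (K w q - qpoch_inf q (q\<^sup>2) ^ 3 * qpoch_inf (q\<^sup>2) (q\<^sup>2) /
               (qpoch_inf (w * q) q * qpoch_inf (inverse w * q) q))"
    if w: "w \<noteq> 0" "\<forall>l::int. w \<noteq> q powi l" for w
    using neg pos w(2) by (intro K1_eq_K[OF q0 assms(2) w(1)]) blast+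
  ultimately show ?thesis by blast
qed

end
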